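(* Let $R$ be a nil ring and let $I$ be a right primitive ideal of the polynomial ring $R[x]$ (if any exists). Then there is a two-sided ideal $I'$ of $R$ such that $I = I'[x]$.
   Context: Rings are associative but need not have an identity. $R[x]$ is the ring of polynomials in one (central) indeterminate $x$ with coefficients in $R$; for an ideal $M$ of $R$, $M[x]$ is the set of polynomials all of whose coefficients lie in $M$. A ring is nil if each of its elements is nilpotent. For a ring $S$, a right ideal $Q$ of $S$ is modular if there is $b\in S$ with $a-ba\in Q$ for every $a\in S$. A modular maximal right ideal is a proper modular right ideal of $S$ that is maximal among the proper right ideals of $S$. A two-sided ideal $P$ of $S$ is right primitive in $S$ if there is a modular maximal right ideal $Q$ of $S$ such that $P$ is the largest two-sided ideal of $S$ contained in $Q$. *)

theory Defs
  imports "HOL-Library.Poly_Mapping"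
begin

text \<open>
  The type class \<^class>\<open>ring\<close> is that of associative rings, not assumed commutative or unital.
  The library's type of univariate polynomials has a multiplication for commutative coefficients
  only; finitely supported maps on the exponents, with their convolution product, form a ring
  over an arbitrary coefficient ring, which is $R[x]$ with $x$ central.
\<close>

type_synonym 'a npoly = "nat \<Rightarrow>\<^sub>0 'a"

definition ideal_poly :: "'a::ring set \<Rightarrow> 'a npoly set" where
  "ideal_poly M = {p. \<forall>n. Poly_Mapping.lookup p n \<in> M}"

text \<open>
  Without an identity there is no zeroth power: the second argument is one less than
  the exponent, so this is $a^{n+1}$.
\<close>

primrec power_Suc_nonunital :: "'a::ring \<Rightarrow> nat \<Rightarrow> 'a" where
  "power_Suc_nonunital a 0 = a"
| "power_Suc_nonunital a (Suc n) = a * power_Suc_nonunital a n"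

definition nilpotent :: "'a::ring \<Rightarrow> bool" where
  "nilpotent a \<longleftrightarrow> (\<exists>n. power_Suc_nonunital a n = 0)"

definition additive_subgroup :: "'a::ring set \<Rightarrow> bool" where
  "additive_subgroup J \<longleftrightarrow> 0 \<in> J \<and> (\<forall>a\<in>J. \<forall>b\<in>J. a + b \<in> J) \<and> (\<forall>a\<in>J. - a \<in> J)"

definition right_ideal :: "'a::ring set \<Rightarrow> bool" where
  "right_ideal J \<longleftrightarrow> additive_subgroup J \<and> (\<forall>a\<in>J. \<forall>s. a * s \<in> J)"

definition two_sided_ideal :: "'a::ring set \<Rightarrow> bool" where
  "two_sided_ideal J \<longleftrightarrow>
     additive_subgroup J \<and> (\<forall>a\<in>J. \<forall>s. a * s \<in> J) \<and> (\<forall>a\<in>J. \<forall>s. s * a \<in> J)"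

definition modular_right_ideal :: "'a::ring set \<Rightarrow> bool" where
  "modular_right_ideal Q \<longleftrightarrow> right_ideal Q \<and> (\<exists>b. \<forall>a. a - b * a \<in> Q)"

definition modular_maximal_right_ideal :: "'a::ring set \<Rightarrow> bool" where
  "modular_maximal_right_ideal Q \<longleftrightarrow>
     modular_right_ideal Q \<and> Q \<noteq> UNIV \<and>
     (\<forall>J. right_ideal J \<and> J \<noteq> UNIV \<and> Q \<subseteq> J \<longrightarrow> J = Q)"

definition right_primitive :: "'a::ring set \<Rightarrow> bool" where
  "right_primitive P \<longleftrightarrow>
     two_sided_ideal P \<and>
     (\<exists>Q. modular_maximal_right_ideal Q \<and> P \<subseteq> Q \<and>
          (\<forall>J. two_sided_ideal J \<and> J \<subseteq> Q \<longrightarrow> J \<subseteq> P))"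

end

theory Submission
  imports Defs
begin

text \<open>
  Let $Q$ be a modular maximal right ideal of $R[x]$ that belongs to $I$, and $M = R[x]/Q$. Then $M$ is
  simple, $I$ is its annihilator, and $x$ acts on $M$ as an injective map commuting with $R$. Let
  $I'$ be the annihilator of $M$ in $R$. Clearly $I'[x] \subseteq I$. If the inclusion is proper,
  some $\sum_{i \le n} a_i x^i$ kills $M$ although $a_n \notin I'$, and this has to be refuted.

  For $n$ minimal, $a_n r a_i$ and $a_i r a_n$ agree on $M$ (\<open>relation_trivial\<close>), so there are
  operators $\lambda_i = a_i/a_n$ on $M$ that commute with $R$ and $x$ and satisfy
  $x^n = -\sum_{i<n} \lambda_i x^i$ (\<open>ratio\<close>, \<open>X_pow_degree\<close>). Over $B = R[\lambda_0,\dots,\lambda_{n-1}]$ the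
  module $M$ is finitely generated, and it follows that it has a simple $B$-submodule $S$ and that
  $M = S \oplus Sx \oplus \dots \oplus Sx^{h-1}$ for some $h$ (\<open>direct_decomposition\<close>).

  Fix $0 \neq v \in S$. Since $R$ is nil, an equation $v = \sum_{i \ge 0} v b_i x^i$ can be solved for
  the constant term, $v = \sum_{1 \le i \le d} v c_i x^i$, and substituting this into its own lowest
  term pushes the exponents up: every $w \in M$ lies in $\sum_{j < i \le j+d} vRx^i$ for all large
  $j$ (\<open>eventually_in_window\<close>). The width $d$ depends on $v$ only. On the other hand
  $v$ generates $S$ over $B$ by simplicity, and an element of $B$ has a power of $a_n$ as
  denominator, so for each $w \in M$ a power $K$ of the ideal generated by $a_n$ satisfies
  $wK \subseteq \sum_{i<h} vRx^i$. Since only the finitely many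
  $vx, \dots, vx^d$ occur in the windows, one $K$ serves for all of them, so the windows times $K$ have width
  $h$. Expressing $v$ through $vp$ with $p \in K$ and $vp \neq 0$ gives
  $$v = \sum_{i<h} v c_i x^{J+i}, \qquad c_i \in R.$$
  The sum $M = \bigoplus_{i<h} S x^{J+i}$ is direct, hence the projection $\delta_i$ of
  $S \subseteq M$ to the $i$-th component $S x^{J+i} \cong S$ is a $B$-endomorphism of the simple module $S$ with
  $\delta_i(v) = v c_i$, and so $\delta_i^m(v) = v c_i^m$. As $c_i$ is nilpotent, $\delta_i$ is not
  injective, thus $\delta_i = 0$ by simplicity. Then $v = 0$, a contradiction.
\<close>

section \<open>Nilpotent elements are quasi-regular\<close>

text \<open>
  The witness is $r + r^2 + r^3 + \dots$; the equation says that $1 + r'$ is a right inverse of $1 - r$.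
\<close>

lemma power_Suc_nonunital_exists_quasi_inverse:
  fixes r :: "'a::ring"
  assumes "nilpotent r"
  shows "\<exists>r'. r' = r + r * r'"
proof -
  define q where "q k = ((\<lambda>s. r + r * s) ^^ k) 0" for k
  have "q (Suc k) - q k = power_Suc_nonunital r k" for k
    by (induction k) (simp_all add: q_def flip: right_diff_distrib)
  moreover obtain k where "power_Suc_nonunital r k = 0"
    using assms unfolding nilpotent_def by blast
  ultimately have "q k = q (Suc k)"
    by (metis eq_iff_diff_eq_0)
  then show ?thesis
    by (auto simp: q_def)
qed

section \<open>Modules over a ring with a commuting shift\<close>

text \<open>
  The module in question is the quotient of \<^typ>\<open>'m\<close> by \<open>Q\<close>, given by representatives:
  an element vanishes if it lies in \<open>Q\<close>, and two elements are equal if their difference does. The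
  operator \<open>X\<close> is the action of the indeterminate, so this is a module over the polynomial ring.
\<close>

locale shift_module =
  fixes act :: "'m::ab_group_add \<Rightarrow> 'r::ring \<Rightarrow> 'm" (infixl "\<star>" 70)
    and X :: "'m \<Rightarrow> 'm"
    and Q :: "'m set"
  assumes act_add_left: "(u + w) \<star> r = u \<star> r + w \<star> r"
    and act_add_right: "u \<star> (r + s) = u \<star> r + u \<star> s"
    and act_mult: "u \<star> (r * s) = u \<star> r \<star> s"
    and X_add: "X (u + w) = X u + X w"
    and X_act: "X (u \<star> r) = X u \<star> r"
    and Q_zero: "0 \<in> Q"
    and Q_add: "u \<in> Q \<Longrightarrow> w \<in> Q \<Longrightarrow> u + w \<in> Q"
    and Q_minus: "u \<in> Q \<Longrightarrow> - u \<in> Q"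
    and Q_act: "u \<in> Q \<Longrightarrow> u \<star> r \<in> Q"
    and Q_X: "u \<in> Q \<Longrightarrow> X u \<in> Q"
begin

lemma act_zero [simp]: "0 \<star> r = 0" "u \<star> 0 = 0"
  using act_add_left[of 0 0 r] act_add_right[of u 0 0] by simp_all

lemma act_minus: "(- u) \<star> r = - (u \<star> r)" "u \<star> (- r) = - (u \<star> r)"
  using act_add_left[of u "- u" r] act_add_right[of u r "- r"]
  by (simp_all add: minus_unique[symmetric])

lemma act_diff: "(u - w) \<star> r = u \<star> r - w \<star> r" "u \<star> (r - s) = u \<star> r - u \<star> s"
  using act_add_left[of u "- w" r] act_add_right[of u r "- s"] by (simp_all add: act_minus)

lemma act_sum: "(\<Sum>i\<in>E. f i) \<star> r = (\<Sum>i\<in>E. f i \<star> r)"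
  by (induction E rule: infinite_finite_induct) (simp_all add: act_add_left)

lemma X_zero [simp]: "X 0 = 0"
  using X_add[of 0 0] by simp

lemma X_pow_zero [simp]: "(X ^^ i) 0 = 0"
  by (induction i) simp_all

lemma X_pow_add: "(X ^^ i) (u + w) = (X ^^ i) u + (X ^^ i) w"
  by (induction i) (simp_all add: X_add)

lemma X_pow_minus: "(X ^^ i) (- u) = - (X ^^ i) u"
  using X_pow_add[of i u "- u"] by (simp add: minus_unique[symmetric])

lemma X_pow_diff: "(X ^^ i) (u - w) = (X ^^ i) u - (X ^^ i) w"
  using X_pow_add[of i u "- w"] by (simp add: X_pow_minus)

lemma X_pow_sum: "(X ^^ i) (\<Sum>k\<in>E. f k) = (\<Sum>k\<in>E. (X ^^ i) (f k))"
  by (induction E rule: infinite_finite_induct) (simp_all add: X_pow_add)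

lemma X_pow_act: "(X ^^ i) (u \<star> r) = (X ^^ i) u \<star> r"
  by (induction i) (simp_all add: X_act)

lemma X_pow_pow: "(X ^^ i) ((X ^^ k) u) = (X ^^ (i + k)) u"
  by (simp add: funpow_add)

lemma Q_X_pow: "u \<in> Q \<Longrightarrow> (X ^^ i) u \<in> Q"
  by (induction i) (simp_all add: Q_X)

lemma Q_diff: "u \<in> Q \<Longrightarrow> w \<in> Q \<Longrightarrow> u - w \<in> Q"
  using Q_add[of u "- w"] Q_minus[of w] by simp

lemma Q_sum: "(\<And>i. i \<in> E \<Longrightarrow> f i \<in> Q) \<Longrightarrow> (\<Sum>i\<in>E. f i) \<in> Q"
  by (induction E rule: infinite_finite_induct) (simp_all add: Q_zero Q_add)

lemma Q_trans: "u - w \<in> Q \<Longrightarrow> w - z \<in> Q \<Longrightarrow> u - z \<in> Q"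
  using Q_add[of "u - w" "w - z"] by simp

lemma Q_sym: "u - w \<in> Q \<Longrightarrow> w - u \<in> Q"
  using Q_minus[of "u - w"] by simp

text \<open>
  The submodules are those over the coefficient ring; they need not be stable under \<open>X\<close>. They
  contain \<open>Q\<close>, so they are full preimages of the submodules of the quotient.
\<close>

definition submodule :: "'m set \<Rightarrow> bool" where
  "submodule Y \<longleftrightarrow> Q \<subseteq> Y \<and> (\<forall>u\<in>Y. \<forall>w\<in>Y. u + w \<in> Y) \<and> (\<forall>u\<in>Y. - u \<in> Y) \<and>
     (\<forall>u\<in>Y. \<forall>r. u \<star> r \<in> Y)"

lemma submoduleI:
  assumes "Q \<subseteq> Y" "\<And>u w. u \<in> Y \<Longrightarrow> w \<in> Y \<Longrightarrow> u + w \<in> Y" "\<And>u. u \<in> Y \<Longrightarrow> - u \<in> Y"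
    "\<And>u r. u \<in> Y \<Longrightarrow> u \<star> r \<in> Y"
  shows "submodule Y"
  using assms by (auto simp: submodule_def)

lemma
  assumes "submodule Y"
  shows submodule_Q: "u \<in> Q \<Longrightarrow> u \<in> Y"
    and submodule_add: "u \<in> Y \<Longrightarrow> w \<in> Y \<Longrightarrow> u + w \<in> Y"
    and submodule_minus: "u \<in> Y \<Longrightarrow> - u \<in> Y"
    and submodule_act: "u \<in> Y \<Longrightarrow> u \<star> r \<in> Y"
  using assms by (auto simp: submodule_def)

lemma submodule_diff: "submodule Y \<Longrightarrow> u \<in> Y \<Longrightarrow> w \<in> Y \<Longrightarrow> u - w \<in> Y"
  using submodule_add[of Y u "- w"] submodule_minus[of Y w] by simp

lemma submodule_sum: "submodule Y \<Longrightarrow> (\<And>i. i \<in> E \<Longrightarrow> f i \<in> Y) \<Longrightarrow> (\<Sum>i\<in>E. f i) \<in> Y"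
  by (induction E rule: infinite_finite_induct)
    (simp_all add: submodule_add submodule_Q Q_zero)

lemma submodule_cong:
  assumes Y: "submodule Y" and "u - w \<in> Q"
  shows "u \<in> Y \<longleftrightarrow> w \<in> Y"
  using submodule_add[OF Y submodule_Q[OF Y assms(2)], of w]
    submodule_diff[OF Y _ submodule_Q[OF Y assms(2)], of u] by auto

lemma submodule_Q_self: "submodule Q"
  by (rule submoduleI) (simp_all add: Q_add Q_minus Q_act)

definition cyclic :: "'m \<Rightarrow> 'm set" where
  "cyclic v = {w. \<exists>r. w - v \<star> r \<in> Q}"

lemma cyclic_act: "v \<star> r \<in> cyclic v"
  unfolding cyclic_def by (auto intro!: exI[of _ r] simp: Q_zero)

lemma submodule_cyclic: "submodule (cyclic v)"
proof (rule submoduleI)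
  show "Q \<subseteq> cyclic v"
    unfolding cyclic_def by (auto intro!: exI[of _ 0])
  show "u + w \<in> cyclic v" if uw: "u \<in> cyclic v" "w \<in> cyclic v" for u w
  proof -
    obtain r s where "u - v \<star> r \<in> Q" "w - v \<star> s \<in> Q"
      using uw unfolding cyclic_def by blast
    from Q_add[OF this] have "u + w - v \<star> (r + s) \<in> Q"
      by (simp add: act_add_right algebra_simps)
    then show ?thesis
      unfolding cyclic_def by blast
  qed
  show "- u \<in> cyclic v" if u: "u \<in> cyclic v" for u
  proof -
    obtain r where "u - v \<star> r \<in> Q"
      using u unfolding cyclic_def by blast
    from Q_minus[OF this] have "- u - v \<star> (- r) \<in> Q"
      by (simp add: act_minus)
    then show ?thesis
      unfolding cyclic_def by blast
  qed
  show "u \<star> s \<in> cyclic v" if u: "u \<in> cyclic v" for u s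
  proof -
    obtain r where "u - v \<star> r \<in> Q"
      using u unfolding cyclic_def by blast
    from Q_act[OF this] have "u \<star> s - v \<star> (r * s) \<in> Q"
      by (simp add: act_diff act_mult)
    then show ?thesis
      unfolding cyclic_def by blast
  qed
qed

text \<open>
  This is $\sum_{i \in E} A x^i$.
\<close>

definition translates :: "'m set \<Rightarrow> nat set \<Rightarrow> 'm set" where
  "translates A E = {w. \<exists>y. (\<forall>i\<in>E. y i \<in> A) \<and> w - (\<Sum>i\<in>E. (X ^^ i) (y i)) \<in> Q}"

lemma translatesI:
  "(\<And>i. i \<in> E \<Longrightarrow> y i \<in> A) \<Longrightarrow> w - (\<Sum>i\<in>E. (X ^^ i) (y i)) \<in> Q \<Longrightarrow> w \<in> translates A E"
  unfolding translates_def by blast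

lemma translatesE:
  assumes "w \<in> translates A E"
  obtains y where "\<forall>i\<in>E. y i \<in> A" "w - (\<Sum>i\<in>E. (X ^^ i) (y i)) \<in> Q"
  using assms unfolding translates_def by blast

lemma submodule_translates:
  assumes A: "submodule A"
  shows "submodule (translates A E)"
proof (rule submoduleI)
  show "Q \<subseteq> translates A E"
    by (auto intro!: translatesI[where y = "\<lambda>_. 0"] simp: submodule_Q[OF A] Q_zero)
  show "u + w \<in> translates A E" if uw: "u \<in> translates A E" "w \<in> translates A E" for u w
  proof -
    obtain y where y: "\<forall>i\<in>E. y i \<in> A" "u - (\<Sum>i\<in>E. (X ^^ i) (y i)) \<in> Q"
      using uw(1) by (rule translatesE)
    obtain z where z: "\<forall>i\<in>E. z i \<in> A" "w - (\<Sum>i\<in>E. (X ^^ i) (z i)) \<in> Q"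
      using uw(2) by (rule translatesE)
    show ?thesis
    proof (rule translatesI)
      show "y i + z i \<in> A" if "i \<in> E" for i
        using y z that by (simp add: submodule_add[OF A])
      show "u + w - (\<Sum>i\<in>E. (X ^^ i) (y i + z i)) \<in> Q"
        using Q_add[OF y(2) z(2)] by (simp add: X_pow_add sum.distrib algebra_simps)
    qed
  qed
  show "- u \<in> translates A E" if u: "u \<in> translates A E" for u
  proof -
    obtain y where y: "\<forall>i\<in>E. y i \<in> A" "u - (\<Sum>i\<in>E. (X ^^ i) (y i)) \<in> Q"
      using u by (rule translatesE)
    show ?thesis
    proof (rule translatesI)
      show "- y i \<in> A" if "i \<in> E" for i
        using y that by (simp add: submodule_minus[OF A])
      show "- u - (\<Sum>i\<in>E. (X ^^ i) (- y i)) \<in> Q"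
        using Q_minus[OF y(2)] by (simp add: X_pow_minus sum_negf algebra_simps)
    qed
  qed
  show "u \<star> r \<in> translates A E" if u: "u \<in> translates A E" for u r
  proof -
    obtain y where y: "\<forall>i\<in>E. y i \<in> A" "u - (\<Sum>i\<in>E. (X ^^ i) (y i)) \<in> Q"
      using u by (rule translatesE)
    show ?thesis
    proof (rule translatesI)
      show "y i \<star> r \<in> A" if "i \<in> E" for i
        using y that by (simp add: submodule_act[OF A])
      show "u \<star> r - (\<Sum>i\<in>E. (X ^^ i) (y i \<star> r)) \<in> Q"
        using Q_act[OF y(2), of r] by (simp add: X_pow_act act_sum act_diff)
    qed
  qed
qed

lemma translates_pow:
  assumes A: "submodule A" and E: "finite E" and iE: "i \<in> E" and y: "y \<in> A"
  shows "(X ^^ i) y \<in> translates A E"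
proof (rule translatesI)
  show "(if k = i then y else 0) \<in> A" for k
    using y submodule_Q[OF A Q_zero] by simp
  have "(\<Sum>k\<in>E. (X ^^ k) (if k = i then y else 0)) = (\<Sum>k\<in>E. if k = i then (X ^^ k) y else 0)"
    by (intro sum.cong) auto
  then show "(X ^^ i) y - (\<Sum>k\<in>E. (X ^^ k) (if k = i then y else 0)) \<in> Q"
    using E iE by (simp add: Q_zero)
qed

lemma translates_least:
  assumes Y: "submodule Y" and A: "\<And>i y. i \<in> E \<Longrightarrow> y \<in> A \<Longrightarrow> (X ^^ i) y \<in> Y"
  shows "translates A E \<subseteq> Y"
proof
  fix w
  assume "w \<in> translates A E"
  then obtain y where y: "\<forall>i\<in>E. y i \<in> A" "w - (\<Sum>i\<in>E. (X ^^ i) (y i)) \<in> Q"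
    by (rule translatesE)
  have "(\<Sum>i\<in>E. (X ^^ i) (y i)) \<in> Y"
    using A y(1) by (intro submodule_sum[OF Y]) blast
  then show "w \<in> Y"
    using submodule_cong[OF Y y(2)] by blast
qed

lemma translates_shift:
  assumes w: "w \<in> translates A E"
  shows "(X ^^ j) w \<in> translates A ((+) j ` E)"
proof -
  obtain y where y: "\<forall>i\<in>E. y i \<in> A" "w - (\<Sum>i\<in>E. (X ^^ i) (y i)) \<in> Q"
    using w by (rule translatesE)
  show ?thesis
  proof (rule translatesI[where y = "\<lambda>i. y (i - j)"])
    show "y (i - j) \<in> A" if "i \<in> (+) j ` E" for i
      using that y(1) by auto
    show "(X ^^ j) w - (\<Sum>i\<in>(+) j ` E. (X ^^ i) (y (i - j))) \<in> Q"
      using Q_X_pow[OF y(2), of j]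
      by (simp add: sum.reindex X_pow_diff X_pow_sum funpow_add)
  qed
qed

lemma translates_interval_shift:
  "w \<in> translates A {a..b} \<Longrightarrow> (X ^^ j) w \<in> translates A {j + a..j + b}"
  using translates_shift[of w A "{a..b}" j] by (simp add: add.commute)

lemma submodule_vimage:
  assumes Y: "submodule Y"
  shows "submodule {z. (X ^^ i) z \<in> Y}"
  by (rule submoduleI)
    (auto simp: X_pow_add X_pow_minus X_pow_act Q_X_pow submodule_Q[OF Y] submodule_add[OF Y]
      submodule_minus[OF Y] submodule_act[OF Y])

lemma submodule_Int: "submodule Y \<Longrightarrow> submodule Z \<Longrightarrow> submodule (Y \<inter> Z)"
  by (auto simp: submodule_def)

end

section \<open>Simple modules over polynomial rings with nil coefficients\<close>

locale simple_shift_module = shift_module +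
  assumes simple: "u \<notin> Q \<Longrightarrow> \<exists>k r. w - (\<Sum>i<k. (X ^^ i) (u \<star> r i)) \<in> Q"
    and nil: "nilpotent (r::'b)"
begin

lemma submodule_X_UNIV:
  assumes Y: "submodule Y" and XY: "\<And>u. u \<in> Y \<Longrightarrow> X u \<in> Y" and u: "u \<in> Y" "u \<notin> Q"
  shows "w \<in> Y"
proof -
  obtain k r where w: "w - (\<Sum>i<k. (X ^^ i) (u \<star> r i)) \<in> Q"
    using simple[OF u(2)] by blast
  have "(X ^^ i) z \<in> Y" if "z \<in> Y" for i z
    using that by (induction i) (simp_all add: XY)
  then show ?thesis
    using submodule_cong[OF Y w] by (auto intro!: submodule_sum[OF Y] submodule_act[OF Y] u(1))
qed

text \<open>
  If $u = ur$, then $u = u(1-r)(1+r') = 0$ for the quasi-inverse $r'$ of $r$.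
\<close>

lemma eigenvector_Q:
  assumes u: "u - u \<star> r \<in> Q"
  shows "u \<in> Q"
proof -
  obtain r' where r': "r' = r + r * r'"
    using power_Suc_nonunital_exists_quasi_inverse[OF nil] by blast
  have "u \<star> r' = u \<star> r + u \<star> r \<star> r'"
    by (subst r') (simp add: act_add_right act_mult)
  then have "u = (u - u \<star> r) + (u - u \<star> r) \<star> r'"
    by (simp add: act_diff)
  then show ?thesis
    using Q_add[OF u Q_act[OF u, of r']] by simp
qed

text \<open>
  If $ux = 0$ and $u \neq 0$, then $u \in uR[x] = uR$, contrary to \<open>eigenvector_Q\<close>.
\<close>

lemma X_inj:
  assumes "X u \<in> Q"
  shows "u \<in> Q"
proof (rule ccontr)
  assume u: "u \<notin> Q"
  obtain k r where k: "u - (\<Sum>i<k. (X ^^ i) (u \<star> r i)) \<in> Q"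
    using simple[OF u] by blast
  have *: "(X ^^ Suc i) (u \<star> s) \<in> Q" for i s
    using Q_X_pow[OF Q_act[OF assms]] by (simp add: X_act funpow_swap1)
  have "(\<Sum>i<k. (X ^^ i) (u \<star> r i)) - u \<star> (if k = 0 then 0 else r 0) \<in> Q"
    using Q_sum[OF *]
    by (cases k) (simp_all add: sum.lessThan_Suc_shift Q_zero del: sum.lessThan_Suc funpow.simps(2))
  from Q_trans[OF k this] show False
    using eigenvector_Q u by blast
qed

lemma X_pow_inj: "(X ^^ i) u \<in> Q \<Longrightarrow> u \<in> Q"
  by (induction i) (auto dest: X_inj)

text \<open>
  In $v = \sum_i v b_i x^i$ the term $v b_0$ moves to the left, and $1 - b_0$ is invertible because
  $R$ is nil.
\<close>

lemma generator_window:
  assumes v: "v \<notin> Q"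
  obtains d where "v \<in> translates (cyclic v) {1..d}"
proof -
  obtain k r where k: "v - (\<Sum>i<k. (X ^^ i) (v \<star> r i)) \<in> Q"
    using simple[OF v] by blast
  then have "k \<noteq> 0"
    using v by (cases k) auto
  then obtain d where d: "k = Suc d"
    by (cases k) auto
  obtain s where s: "s = r 0 + r 0 * s"
    using power_Suc_nonunital_exists_quasi_inverse[OF nil] by blast
  let ?T = "translates (cyclic v) {1..d}"
  note T = submodule_translates[OF submodule_cyclic, of v "{1..d}"]
  have "(\<Sum>i<d. (X ^^ Suc i) (v \<star> r (Suc i))) \<in> ?T"
    using translates_pow[OF submodule_cyclic _ _ cyclic_act, of "{1..d}"]
    by (intro submodule_sum[OF T]) (simp del: funpow.simps)
  moreover have "(v - v \<star> r 0) - (\<Sum>i<d. (X ^^ Suc i) (v \<star> r (Suc i))) \<in> Q"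
    using k unfolding d
    by (simp add: sum.lessThan_Suc_shift algebra_simps del: sum.lessThan_Suc funpow.simps(2))
  ultimately have w: "v - v \<star> r 0 \<in> ?T"
    using submodule_cong[OF T] by blast
  have "v \<star> s = v \<star> r 0 + v \<star> r 0 \<star> s"
    by (subst s) (simp add: act_add_right act_mult)
  then have "v = (v - v \<star> r 0) + (v - v \<star> r 0) \<star> s"
    by (simp add: act_diff)
  then have "v \<in> ?T"
    using submodule_add[OF T w submodule_act[OF T w, of s]] by simp
  then show thesis
    by (rule that)
qed

text \<open>
  The window moves up by one step when its lowest term $v r x^{j+1}$ is replaced by means of the
  original relation multiplied by $r x^{j+1}$. The width stays the same.
\<close>

lemma generator_window_shift:
  assumes v: "v \<in> translates (cyclic v) {1..d}"
  shows "v \<in> translates (cyclic v) {j + 1..j + d}"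
proof (induction j)
  case 0
  then show ?case using v by simp
next
  case (Suc j)
  let ?T = "translates (cyclic v) {Suc j + 1..Suc j + d}"
  note T = submodule_translates[OF submodule_cyclic, of v "{Suc j + 1..Suc j + d}"]
  have first: "(X ^^ Suc j) (v \<star> r) \<in> ?T" for r
    using translates_interval_shift[OF submodule_act[OF submodule_translates[OF submodule_cyclic] v,
          of r], of "Suc j"]
    by (simp del: funpow.simps)
  have "translates (cyclic v) {j + 1..j + d} \<subseteq> ?T"
  proof (rule translates_least[OF T])
    fix i y
    assume i: "i \<in> {j + 1..j + d}" and "y \<in> cyclic v"
    then obtain r where r: "y - v \<star> r \<in> Q"
      unfolding cyclic_def by blast
    have "(X ^^ i) (v \<star> r) \<in> ?T"
    proof (cases "i = Suc j")
      case True
      then show ?thesis using first by simp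
    next
      case False
      then show ?thesis
        using i by (intro translates_pow submodule_cyclic cyclic_act) auto
    qed
    moreover have "(X ^^ i) y - (X ^^ i) (v \<star> r) \<in> Q"
      using Q_X_pow[OF r] by (simp add: X_pow_diff)
    ultimately show "(X ^^ i) y \<in> ?T"
      using submodule_cong[OF T] by blast
  qed
  then show ?case using Suc.IH by blast
qed

text \<open>
  The width $d$ does not depend on $w$: this uniformity is what the final argument exploits.
\<close>

lemma eventually_in_window:
  assumes v: "v \<notin> Q" "v \<in> translates (cyclic v) {1..d}"
  shows "\<exists>j0. \<forall>j\<ge>j0. w \<in> translates (cyclic v) {j + 1..j + d}"
proof -
  obtain k r where w: "w - (\<Sum>i<k. (X ^^ i) (v \<star> r i)) \<in> Q"
    using simple[OF v(1)] by blast
  have "w \<in> translates (cyclic v) {j + 1..j + d}" if "k \<le> j" for j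
  proof -
    note T = submodule_translates[OF submodule_cyclic, of v "{j + 1..j + d}"]
    have "(X ^^ i) (v \<star> r i) \<in> translates (cyclic v) {j + 1..j + d}" if "i < k" for i
      using translates_interval_shift[OF submodule_act[OF submodule_translates[OF submodule_cyclic]
            generator_window_shift[OF v(2), of "j - i"], of "r i"], of i] that \<open>k \<le> j\<close>
      by simp
    then have "(\<Sum>i<k. (X ^^ i) (v \<star> r i)) \<in> translates (cyclic v) {j + 1..j + d}"
      by (intro submodule_sum[OF T]) simp
    then show ?thesis
      using submodule_cong[OF T w] by blast
  qed
  then show ?thesis by blast
qed

end


section \<open>Ratios of the coefficients of a relation\<close>

text \<open>
  A polynomial with leading coefficient \<open>a n\<close> outside the annihilator kills the module. The condition
  \<open>commute\<close> holds for a relation of minimal degree. The assumptions are contradictory, as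
  \<open>no_proper_relation\<close> shows below.
\<close>

locale algebraic_shift_module = simple_shift_module +
  fixes a :: "nat \<Rightarrow> 'b" and n :: nat
  assumes relation: "(\<Sum>i\<le>n. (X ^^ i) (u \<star> a i)) \<in> Q"
    and lead: "\<exists>u. u \<star> a n \<notin> Q"
    and commute: "i \<le> n \<Longrightarrow> u \<star> (a n * r * a i) - u \<star> (a i * r * a n) \<in> Q"
begin

lemma degree_pos: "0 < n"
  using relation lead by (cases n) auto

text \<open>
  If $wRa_n = 0$ and $w \neq 0$, then $Ma_n = wR[x]a_n = 0$.
\<close>

lemma torsion_free:
  assumes w: "\<And>s. w \<star> (s * a n) \<in> Q"
  shows "w \<in> Q"
proof (rule ccontr)
  assume "w \<notin> Q"
  obtain u where u: "u \<star> a n \<notin> Q"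
    using lead by blast
  obtain k r where "u - (\<Sum>i<k. (X ^^ i) (w \<star> r i)) \<in> Q"
    using simple[OF \<open>w \<notin> Q\<close>] by blast
  from Q_act[OF this, of "a n"]
  have "u \<star> a n - (\<Sum>i<k. (X ^^ i) (w \<star> (r i * a n))) \<in> Q"
    by (simp add: act_diff act_sum act_mult X_pow_act)
  moreover have "(\<Sum>i<k. (X ^^ i) (w \<star> (r i * a n))) \<in> Q"
    by (intro Q_sum Q_X_pow w)
  ultimately show False
    using u submodule_cong[OF submodule_Q_self] by blast
qed

text \<open>
  The action of $a_i/a_n$. By \<open>torsion_free\<close> its value is determined modulo \<open>Q\<close> only, so it is
  additive, and commutes with scalars and \<open>X\<close>, up to \<open>Q\<close>.
\<close>

definition ratio :: "nat \<Rightarrow> 'a \<Rightarrow> 'a" where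
  "ratio i u = (SOME z. \<forall>s. z \<star> (s * a n) - u \<star> (s * a i) \<in> Q)"

text \<open>
  As $M = w a_n R[x]$ for some $w$, one may write $u = \sum_l w a_n r_l x^l$, and then
  $\sum_l w a_i r_l x^l$ is the required element.
\<close>

lemma ratio:
  assumes i: "i \<le> n"
  shows "ratio i u \<star> (s * a n) - u \<star> (s * a i) \<in> Q"
proof -
  obtain w where w: "w \<star> a n \<notin> Q"
    using lead by blast
  obtain k r where k: "u - (\<Sum>l<k. (X ^^ l) (w \<star> a n \<star> r l)) \<in> Q"
    using simple[OF w] by blast
  define z where "z = (\<Sum>l<k. (X ^^ l) (w \<star> a i \<star> r l))"
  have "z \<star> (t * a n) - u \<star> (t * a i) \<in> Q" for t
  proof -
    have "(\<Sum>l<k. (X ^^ l) (w \<star> (a n * (r l * t) * a i) - w \<star> (a i * (r l * t) * a n))) \<in> Q"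
      by (intro Q_sum Q_X_pow commute i)
    then have "(\<Sum>l<k. (X ^^ l) (w \<star> a n \<star> r l)) \<star> (t * a i) - z \<star> (t * a n) \<in> Q"
      by (simp add: z_def act_sum act_mult X_pow_act X_pow_diff sum_subtractf)
    with Q_act[OF k, of "t * a i"] have "u \<star> (t * a i) - z \<star> (t * a n) \<in> Q"
      unfolding act_diff by (rule Q_trans)
    then show ?thesis
      by (rule Q_sym)
  qed
  then have "\<exists>z. \<forall>s. z \<star> (s * a n) - u \<star> (s * a i) \<in> Q"
    by blast
  then show ?thesis
    unfolding ratio_def by (rule someI2_ex) blast
qed

lemma ratio_unique:
  assumes i: "i \<le> n" and z: "\<And>s. z \<star> (s * a n) - u \<star> (s * a i) \<in> Q"
  shows "z - ratio i u \<in> Q"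
proof (rule torsion_free)
  show "(z - ratio i u) \<star> (s * a n) \<in> Q" for s
    using Q_trans[OF z Q_sym[OF ratio[OF i]]] by (simp add: act_diff)
qed

lemma ratio_add:
  assumes "i \<le> n"
  shows "(ratio i u + ratio i w) - ratio i (u + w) \<in> Q"
proof (rule ratio_unique[OF assms])
  show "(ratio i u + ratio i w) \<star> (s * a n) - (u + w) \<star> (s * a i) \<in> Q" for s
    using Q_add[OF ratio[OF assms, of u s] ratio[OF assms, of w s]]
    by (simp add: act_add_left algebra_simps)
qed

lemma ratio_minus:
  assumes "i \<le> n"
  shows "- ratio i u - ratio i (- u) \<in> Q"
proof (rule ratio_unique[OF assms])
  show "(- ratio i u) \<star> (s * a n) - (- u) \<star> (s * a i) \<in> Q" for s
    using Q_minus[OF ratio[OF assms, of u s]] by (simp add: act_minus algebra_simps)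
qed

lemma ratio_act:
  assumes "i \<le> n"
  shows "ratio i u \<star> r - ratio i (u \<star> r) \<in> Q"
proof (rule ratio_unique[OF assms])
  show "(ratio i u \<star> r) \<star> (s * a n) - (u \<star> r) \<star> (s * a i) \<in> Q" for s
    using ratio[OF assms, of u "r * s"] by (simp add: act_mult)
qed

lemma ratio_X_pow:
  assumes "i \<le> n"
  shows "(X ^^ k) (ratio i u) - ratio i ((X ^^ k) u) \<in> Q"
proof (rule ratio_unique[OF assms])
  show "(X ^^ k) (ratio i u) \<star> (s * a n) - (X ^^ k) u \<star> (s * a i) \<in> Q" for s
    using Q_X_pow[OF ratio[OF assms, of u s]] by (simp add: X_pow_diff X_pow_act)
qed

lemma ratio_Q:
  assumes "i \<le> n" "u \<in> Q"
  shows "ratio i u \<in> Q"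
proof -
  have "0 - ratio i u \<in> Q"
    by (rule ratio_unique[OF assms(1)]) (simp add: Q_minus Q_act assms(2))
  then show ?thesis
    using Q_minus by fastforce
qed

text \<open>
  The relation divided by its leading coefficient: multiplying the left-hand side by $s a_n$ gives
  the original relation at $us$.
\<close>

lemma X_pow_degree: "(X ^^ n) u + (\<Sum>i<n. (X ^^ i) (ratio i u)) \<in> Q"
proof (rule torsion_free)
  fix s
  have "(\<Sum>i<n. (X ^^ i) (ratio i u \<star> (s * a n) - u \<star> (s * a i))) \<in> Q"
    by (intro Q_sum Q_X_pow ratio) simp
  moreover have "(\<Sum>i<n. (X ^^ i) (u \<star> s \<star> a i)) + (X ^^ n) (u \<star> s \<star> a n) \<in> Q"
    using relation[of "u \<star> s"] by (simp flip: lessThan_Suc_atMost)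
  ultimately show "((X ^^ n) u + (\<Sum>i<n. (X ^^ i) (ratio i u))) \<star> (s * a n) \<in> Q"
    using Q_add
    by (fastforce simp: act_add_left act_sum act_mult X_pow_act X_pow_diff sum_subtractf
        algebra_simps)
qed

text \<open>
  A submodule over the ring $B$ generated by $R$ and the ratios.
\<close>

definition ratio_submodule :: "'a set \<Rightarrow> bool" where
  "ratio_submodule Y \<longleftrightarrow> submodule Y \<and> (\<forall>i<n. \<forall>u\<in>Y. ratio i u \<in> Y)"

lemma ratio_submoduleD:
  assumes "ratio_submodule Y"
  shows "submodule Y" "i < n \<Longrightarrow> u \<in> Y \<Longrightarrow> ratio i u \<in> Y"
  using assms by (auto simp: ratio_submodule_def)

lemma ratio_submodule_Q: "ratio_submodule Q"
  by (simp add: ratio_submodule_def submodule_Q_self ratio_Q)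

lemma ratio_submodule_Int:
  "ratio_submodule Y \<Longrightarrow> ratio_submodule Z \<Longrightarrow> ratio_submodule (Y \<inter> Z)"
  by (simp add: ratio_submodule_def submodule_Int)

lemma ratio_submodule_vimage:
  assumes Y: "ratio_submodule Y"
  shows "ratio_submodule {z. (X ^^ i) z \<in> Y}"
  unfolding ratio_submodule_def
proof (intro conjI allI impI ballI)
  show "submodule {z. (X ^^ i) z \<in> Y}"
    by (rule submodule_vimage[OF ratio_submoduleD(1)[OF Y]])
  show "ratio k u \<in> {z. (X ^^ i) z \<in> Y}" if "k < n" "u \<in> {z. (X ^^ i) z \<in> Y}" for k u
    using that ratio_submoduleD(2)[OF Y, of k "(X ^^ i) u"]
      submodule_cong[OF ratio_submoduleD(1)[OF Y] ratio_X_pow[of k i u]] by simp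
qed

lemma ratio_submodule_translates:
  assumes Y: "ratio_submodule Y" and E: "finite E"
  shows "ratio_submodule (translates Y E)"
  unfolding ratio_submodule_def
proof (intro conjI allI impI ballI)
  let ?T = "translates Y E"
  show T: "submodule ?T"
    by (rule submodule_translates[OF ratio_submoduleD(1)[OF Y]])
  fix k u
  assume k: "k < n" and u: "u \<in> ?T"
  define S where "S = {w \<in> ?T. ratio k w \<in> ?T}"
  have "submodule S"
  proof (rule submoduleI)
    show "Q \<subseteq> S"
      using k by (auto simp: S_def submodule_Q[OF T] ratio_Q)
    show "u + w \<in> S" if "u \<in> S" "w \<in> S" for u w
      using that submodule_cong[OF T ratio_add[of k u w]] k by (simp add: S_def submodule_add[OF T])
    show "- u \<in> S" if "u \<in> S" for u
      using that submodule_cong[OF T ratio_minus[of k u]] k by (simp add: S_def submodule_minus[OF T])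
    show "u \<star> r \<in> S" if "u \<in> S" for u r
      using that submodule_cong[OF T ratio_act[of k u r]] k by (simp add: S_def submodule_act[OF T])
  qed
  then have "?T \<subseteq> S"
  proof (rule translates_least)
    fix i y
    assume "i \<in> E" "y \<in> Y"
    then have "(X ^^ i) y \<in> ?T" "(X ^^ i) (ratio k y) \<in> ?T"
      using ratio_submoduleD[OF Y] k E by (auto intro!: translates_pow)
    then show "(X ^^ i) y \<in> S"
      using submodule_cong[OF T ratio_X_pow[of k i y]] k by (simp add: S_def)
  qed
  then show "ratio k u \<in> ?T"
    using u by (auto simp: S_def)
qed

text \<open>
  $M$ is finitely generated over $B$: by \<open>X_pow_degree\<close>, the elements $v, vx, \dots, vx^{n-1}$ yield
  every $vx^m$.
\<close>

lemma ratio_submodule_UNIV: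
  assumes Y: "ratio_submodule Y" and v: "v \<notin> Q" "\<And>i. i < n \<Longrightarrow> (X ^^ i) v \<in> Y"
  shows "Y = UNIV"
proof -
  note Y' = ratio_submoduleD(1)[OF Y]
  have pow: "(X ^^ m) v \<in> Y" for m
  proof (induction m rule: less_induct)
    case (less m)
    show ?case
    proof (cases "m < n")
      case False
      then obtain j where j: "m = j + n"
        by (metis add.commute le_Suc_ex not_less)
      have "(X ^^ j) ((X ^^ n) v) - (X ^^ j) (- (\<Sum>i<n. (X ^^ i) (ratio i v))) \<in> Q"
        using Q_X_pow[OF X_pow_degree, of j v] by (simp add: X_pow_add X_pow_minus)
      moreover have "(X ^^ (j + i)) (ratio i v) \<in> Y" if "i < n" for i
        using that less[of "j + i"] submodule_cong[OF Y' ratio_X_pow[of i "j + i" v]]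
          ratio_submoduleD(2)[OF Y] by (simp add: j)
      then have "(X ^^ j) (- (\<Sum>i<n. (X ^^ i) (ratio i v))) \<in> Y"
        by (auto simp: X_pow_minus X_pow_sum X_pow_pow intro!: submodule_minus[OF Y'] submodule_sum[OF Y'])
      ultimately show ?thesis
        using submodule_cong[OF Y'] by (simp add: j funpow_add)
    qed (rule v(2))
  qed
  have "w \<in> Y" for w
  proof -
    obtain k r where w: "w - (\<Sum>i<k. (X ^^ i) (v \<star> r i)) \<in> Q"
      using simple[OF v(1)] by blast
    have "(\<Sum>i<k. (X ^^ i) (v \<star> r i)) \<in> Y"
      by (intro submodule_sum[OF Y']) (simp add: X_pow_act submodule_act[OF Y'] pow)
    then show ?thesis
      using submodule_cong[OF Y' w] by blast
  qed
  then show ?thesis by blast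
qed

section \<open>Decomposition into shifts of a simple submodule\<close>

text \<open>
  By finite generation, the union of a chain of proper submodules is proper, so Zorn's lemma applies.
\<close>

lemma maximal_ratio_submodule:
  obtains M where "ratio_submodule M" "M \<noteq> UNIV"
    "\<forall>Y. ratio_submodule Y \<longrightarrow> M \<subseteq> Y \<longrightarrow> Y = UNIV \<or> Y = M"
proof -
  let ?P = "{Y. ratio_submodule Y \<and> Y \<noteq> UNIV}"
  obtain u where "u \<star> a n \<notin> Q"
    using lead by blast
  then obtain v where v: "v \<notin> Q" by blast
  have "\<exists>M\<in>?P. \<forall>Y\<in>?P. M \<subseteq> Y \<longrightarrow> Y = M"
  proof (rule subset_Zorn_nonempty)
    show "?P \<noteq> {}"
      using ratio_submodule_Q v by blast
    show "\<Union>C \<in> ?P" if C: "C \<noteq> {}" "subset.chain ?P C" for C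
    proof -
      have sub: "ratio_submodule Y" "Y \<noteq> UNIV" if "Y \<in> C" for Y
        using C(2) that by (auto simp: subset.chain_def)
      have chain: "Y \<subseteq> Z \<or> Z \<subseteq> Y" if "Y \<in> C" "Z \<in> C" for Y Z
        using C(2) that by (auto simp: subset.chain_def)
      have "submodule (\<Union>C)"
      proof (rule submoduleI)
        show "Q \<subseteq> \<Union>C"
          using C(1) sub(1) submodule_Q[OF ratio_submoduleD(1)] by blast
        show "u + w \<in> \<Union>C" if uw: "u \<in> \<Union>C" "w \<in> \<Union>C" for u w
        proof -
          obtain Y Z where "Y \<in> C" "u \<in> Y" "Z \<in> C" "w \<in> Z"
            using uw by blast
          then obtain T where "T \<in> C" "u \<in> T" "w \<in> T"
            using chain by blast
          then show ?thesis
            using submodule_add[OF ratio_submoduleD(1)[OF sub(1)]] by blast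
        qed
        show "- u \<in> \<Union>C" if "u \<in> \<Union>C" for u
          using that submodule_minus[OF ratio_submoduleD(1)[OF sub(1)]] by blast
        show "u \<star> r \<in> \<Union>C" if "u \<in> \<Union>C" for u r
          using that submodule_act[OF ratio_submoduleD(1)[OF sub(1)]] by blast
      qed
      then have "ratio_submodule (\<Union>C)"
        using sub(1) ratio_submoduleD(2) unfolding ratio_submodule_def by blast
      moreover have "\<Union>C \<noteq> UNIV"
      proof
        assume UN: "\<Union>C = UNIV"
        have "\<exists>Y\<in>C. \<forall>i<m. (X ^^ i) v \<in> Y" for m
        proof (induction m)
          case (Suc m)
          then obtain Y Z where "Y \<in> C" "\<forall>i<m. (X ^^ i) v \<in> Y" "Z \<in> C" "(X ^^ m) v \<in> Z"
            using UN by blast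
          with chain[of Y Z] show ?case
            by (metis less_Suc_eq subsetD)
        qed (use C(1) in blast)
        then show False
          using ratio_submodule_UNIV[OF sub(1) v] sub(2) by blast
      qed
      ultimately show ?thesis by blast
    qed
  qed
  then show thesis
    using that by blast
qed

lemma ratio_submodule_plus_translate:
  assumes M: "ratio_submodule M" and Y: "ratio_submodule Y"
  shows "ratio_submodule {w. \<exists>y\<in>Y. w - (X ^^ m) y \<in> M}" (is "ratio_submodule ?Z")
  unfolding ratio_submodule_def
proof (intro conjI allI impI ballI)
  note M' = ratio_submoduleD(1)[OF M] and Y' = ratio_submoduleD(1)[OF Y]
  show "submodule ?Z"
  proof (rule submoduleI)
    show "Q \<subseteq> ?Z"
      using submodule_Q[OF M'] submodule_Q[OF Y' Q_zero] by (auto intro!: bexI[of _ 0])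
    show "u + w \<in> ?Z" if uw: "u \<in> ?Z" "w \<in> ?Z" for u w
    proof -
      obtain y z where "y \<in> Y" "u - (X ^^ m) y \<in> M" "z \<in> Y" "w - (X ^^ m) z \<in> M"
        using uw by blast
      moreover from this have "u + w - (X ^^ m) (y + z) \<in> M"
        using submodule_add[OF M', of "u - (X ^^ m) y" "w - (X ^^ m) z"]
        by (simp add: X_pow_add algebra_simps)
      ultimately show ?thesis
        using submodule_add[OF Y'] by blast
    qed
    show "- u \<in> ?Z" if u: "u \<in> ?Z" for u
    proof -
      obtain y where "y \<in> Y" "u - (X ^^ m) y \<in> M"
        using u by blast
      moreover from this have "- u - (X ^^ m) (- y) \<in> M"
        using submodule_minus[OF M', of "u - (X ^^ m) y"] by (simp add: X_pow_minus)
      ultimately show ?thesis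
        using submodule_minus[OF Y'] by blast
    qed
    show "u \<star> r \<in> ?Z" if u: "u \<in> ?Z" for u r
    proof -
      obtain y where "y \<in> Y" "u - (X ^^ m) y \<in> M"
        using u by blast
      moreover from this have "u \<star> r - (X ^^ m) (y \<star> r) \<in> M"
        using submodule_act[OF M', of "u - (X ^^ m) y" r] by (simp add: X_pow_act act_diff)
      ultimately show ?thesis
        using submodule_act[OF Y'] by blast
    qed
  qed
  fix i u
  assume i: "i < n" and "u \<in> ?Z"
  then obtain y where y: "y \<in> Y" "u - (X ^^ m) y \<in> M"
    by blast
  have 1: "(X ^^ m) (ratio i y) - ratio i ((X ^^ m) y) \<in> M"
    using i by (intro submodule_Q[OF M'] ratio_X_pow) simp
  have "(ratio i (u - (X ^^ m) y) + ratio i ((X ^^ m) y)) - ratio i u \<in> M"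
    using i ratio_add[of i "u - (X ^^ m) y" "(X ^^ m) y"] by (simp add: submodule_Q[OF M'])
  from submodule_diff[OF M' submodule_diff[OF M' ratio_submoduleD(2)[OF M i y(2)] this] 1]
  have "ratio i u - (X ^^ m) (ratio i y) \<in> M"
    by (simp add: algebra_simps)
  then show "ratio i u \<in> ?Z"
    using ratio_submoduleD(2)[OF Y i y(1)] by blast
qed

text \<open>
  Let $M_0$ be a maximal $B$-submodule and $F_m = \{z \mid z, zx, \dots, zx^{m-1} \in M_0\}$. Then $F_n$ is
  stable under $x$ by \<open>X_pow_degree\<close>, hence zero because $M$ is simple over $R[x]$. For the last
  $m$ with $F_m \neq 0$, multiplication by $x^m$ embeds $F_m$ into the simple module $M/M_0$.
\<close>

lemma simple_ratio_submodule:
  obtains S where "ratio_submodule S" "\<not> S \<subseteq> Q"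
    "\<forall>Y. ratio_submodule Y \<longrightarrow> Y \<subseteq> S \<longrightarrow> Y \<subseteq> Q \<or> Y = S"
proof -
  obtain M where M: "ratio_submodule M" "M \<noteq> UNIV"
    "\<forall>Y. ratio_submodule Y \<longrightarrow> M \<subseteq> Y \<longrightarrow> Y = UNIV \<or> Y = M"
    by (rule maximal_ratio_submodule)
  note M' = ratio_submoduleD(1)[OF M(1)]
  define F where "F m = {z. \<forall>i<m. (X ^^ i) z \<in> M}" for m
  have F_Suc: "F (Suc m) = F m \<inter> {z. (X ^^ m) z \<in> M}" for m
    by (auto simp: F_def less_Suc_eq)
  have F: "ratio_submodule (F m)" for m
  proof (induction m)
    case 0
    show ?case by (simp add: F_def ratio_submodule_def submodule_def)
  next
    case (Suc m)
    then show ?case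
      unfolding F_Suc by (intro ratio_submodule_Int ratio_submodule_vimage M(1))
  qed
  have "F n \<subseteq> Q"
  proof
    fix u
    assume u: "u \<in> F n"
    show "u \<in> Q"
    proof (rule ccontr)
      assume "u \<notin> Q"
      have XF: "X z \<in> F n" if z: "z \<in> F n" for z
      proof -
        have "(X ^^ n) z - (- (\<Sum>i<n. (X ^^ i) (ratio i z))) \<in> Q"
          using X_pow_degree[of z] by simp
        moreover have "(X ^^ i) (ratio i z) \<in> M" if "i < n" for i
          using that z submodule_cong[OF M' ratio_X_pow[of i i z]] ratio_submoduleD(2)[OF M(1)]
          by (simp add: F_def)
        then have "- (\<Sum>i<n. (X ^^ i) (ratio i z)) \<in> M"
          by (intro submodule_minus[OF M'] submodule_sum[OF M']) simp
        ultimately have "(X ^^ n) z \<in> M"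
          using submodule_cong[OF M'] by blast
        then have "(X ^^ Suc i) z \<in> M" if "i < n" for i
          using z that by (cases "Suc i = n") (auto simp: F_def simp del: funpow.simps)
        then show ?thesis
          by (simp add: F_def funpow_swap1)
      qed
      have "w \<in> M" for w
        using submodule_X_UNIV[OF ratio_submoduleD(1)[OF F] XF u \<open>u \<notin> Q\<close>, of w] degree_pos
        by (auto simp: F_def)
      then show False
        using M(2) by blast
    qed
  qed
  moreover have "\<not> F 0 \<subseteq> Q"
    using lead by (auto simp: F_def)
  ultimately obtain m where m: "\<not> F m \<subseteq> Q" "F (Suc m) \<subseteq> Q"
    using dec_induct[of 0 n "\<lambda>m. \<not> F m \<subseteq> Q"] by auto
  have "Y = F m" if Y: "ratio_submodule Y" "Y \<subseteq> F m" "\<not> Y \<subseteq> Q" for Y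
  proof -
    note Y' = ratio_submoduleD(1)[OF Y(1)]
    let ?Z = "{w. \<exists>y\<in>Y. w - (X ^^ m) y \<in> M}"
    obtain y0 where y0: "y0 \<in> Y" "y0 \<notin> Q"
      using Y(3) by blast
    then have "(X ^^ m) y0 \<notin> M"
      using m(2) Y(2) by (auto simp: F_Suc)
    moreover have "(X ^^ m) y0 \<in> ?Z"
      using y0(1) submodule_Q[OF M' Q_zero] by (auto intro!: bexI[of _ y0])
    moreover have "M \<subseteq> ?Z"
      using submodule_Q[OF Y' Q_zero] by (auto intro!: bexI[of _ 0])
    \<comment> \<open>$M_0 + Yx^m$ properly contains $M_0$, so it is everything.\<close>
    ultimately have Z: "?Z = UNIV"
      using M(3) ratio_submodule_plus_translate[OF M(1) Y(1), of m] by blast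
    have "u \<in> Y" if u: "u \<in> F m" for u
    proof -
      obtain y where y: "y \<in> Y" "(X ^^ m) u - (X ^^ m) y \<in> M"
        using Z by blast
      then have "u - y \<in> F (Suc m)"
        using u Y(2) submodule_diff[OF ratio_submoduleD(1)[OF F], of u m y]
        by (auto simp: F_Suc X_pow_diff)
      then have "u - y \<in> Q"
        using m(2) by blast
      then show ?thesis
        using submodule_cong[OF Y'] y(1) by blast
    qed
    then show "Y = F m"
      using Y(2) by blast
  qed
  then show thesis
    using that[OF F m(1)] by blast
qed

text \<open>
  The number $h$ is least such that $Sx^h$ meets $\sum_{i<h} Sx^i$ nontrivially; it exists and is at most $n$
  by \<open>X_pow_degree\<close>. Minimality makes the sum direct. The $w \in S$ with $wx^h$ in
  the sum form a nonzero $B$-submodule, hence all of $S$; so the sum is stable under $x$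
  and equals $M$.
\<close>

lemma direct_decomposition:
  obtains S h where "ratio_submodule S" "\<not> S \<subseteq> Q"
    "\<forall>Y. ratio_submodule Y \<longrightarrow> Y \<subseteq> S \<longrightarrow> Y \<subseteq> Q \<or> Y = S"
    "\<forall>y. (\<forall>i<h. y i \<in> S) \<longrightarrow> (\<Sum>i<h. (X ^^ i) (y i)) \<in> Q \<longrightarrow> (\<forall>i<h. y i \<in> Q)"
    "translates S {..<h} = UNIV"
proof -
  obtain S where S: "ratio_submodule S" "\<not> S \<subseteq> Q"
    "\<forall>Y. ratio_submodule Y \<longrightarrow> Y \<subseteq> S \<longrightarrow> Y \<subseteq> Q \<or> Y = S"
    by (rule simple_ratio_submodule)
  note S' = ratio_submoduleD(1)[OF S(1)]
  define dep where "dep m \<longleftrightarrow> (\<exists>w\<in>S. w \<notin> Q \<and> (X ^^ m) w \<in> translates S {..<m})" for m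
  obtain u where u: "u \<in> S" "u \<notin> Q"
    using S(2) by blast
  have "(X ^^ n) u \<in> translates S {..<n}"
  proof (rule translatesI)
    show "- ratio i u \<in> S" if "i \<in> {..<n}" for i
      using that u(1) ratio_submoduleD[OF S(1)] by (simp add: submodule_minus)
    show "(X ^^ n) u - (\<Sum>i<n. (X ^^ i) (- ratio i u)) \<in> Q"
      using X_pow_degree[of u] by (simp add: X_pow_minus sum_negf)
  qed
  then have "dep n"
    using u by (auto simp: dep_def)
  define h where "h = (LEAST m. dep m)"
  have "dep h"
    unfolding h_def using \<open>dep n\<close> by (rule LeastI)
  have not_dep: "\<not> dep m" if "m < h" for m
    using that unfolding h_def by (rule not_less_Least)
  have "\<not> dep 0"
    by (auto simp: dep_def translates_def)
  then have "0 < h"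
    using \<open>dep h\<close> by (cases h) auto
  have indep: "\<forall>i<m. y i \<in> Q"
    if "m \<le> h" "\<forall>i<h. y i \<in> S" "(\<Sum>i<m. (X ^^ i) (y i)) \<in> Q" for m y
    using that
  proof (induction m)
    case (Suc m)
    have "(X ^^ m) (y m) \<in> translates S {..<m}"
    proof (rule translatesI)
      show "- y i \<in> S" if "i \<in> {..<m}" for i
        using that Suc.prems by (simp add: submodule_minus[OF S'])
      show "(X ^^ m) (y m) - (\<Sum>i<m. (X ^^ i) (- y i)) \<in> Q"
        using Suc.prems(3) by (simp add: X_pow_minus sum_negf add.commute)
    qed
    then have ym: "y m \<in> Q"
      using not_dep[of m] Suc.prems by (auto simp: dep_def)
    then have "(\<Sum>i<m. (X ^^ i) (y i)) \<in> Q"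
      using Q_diff[OF Suc.prems(3) Q_X_pow[OF ym, of m]] by simp
    then show ?case
      using Suc ym by (auto simp: less_Suc_eq)
  qed simp
  let ?T = "translates S {..<h}"
  note T = submodule_translates[OF S', of "{..<h}"]
  have "S \<inter> {w. (X ^^ h) w \<in> ?T} = S"
  proof -
    have "ratio_submodule (S \<inter> {w. (X ^^ h) w \<in> ?T})"
      by (intro ratio_submodule_Int ratio_submodule_vimage ratio_submodule_translates S(1)) simp
    moreover have "\<not> S \<inter> {w. (X ^^ h) w \<in> ?T} \<subseteq> Q"
      using \<open>dep h\<close> by (auto simp: dep_def)
    ultimately show ?thesis
      using S(3) by blast
  qed
  then have wrap: "(X ^^ h) y \<in> ?T" if "y \<in> S" for y
    using that by blast
  have "?T \<subseteq> {w. (X ^^ 1) w \<in> ?T}"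
  proof (rule translates_least[OF submodule_vimage[OF T]])
    fix i y
    assume "i \<in> {..<h}" "y \<in> S"
    then have "(X ^^ Suc i) y \<in> ?T"
      using wrap translates_pow[OF S', of "{..<h}" "Suc i" y] by (cases "Suc i = h") auto
    then show "(X ^^ i) y \<in> {w. (X ^^ 1) w \<in> ?T}"
      by simp
  qed
  then have XT: "X w \<in> ?T" if "w \<in> ?T" for w
    using that by auto
  have "u \<in> ?T"
    using translates_pow[OF S', of "{..<h}" 0 u] u \<open>0 < h\<close> by simp
  then have "w \<in> ?T" for w
    using submodule_X_UNIV[OF T XT] u(2) by blast
  then have "?T = UNIV"
    by blast
  then show thesis
    using that[OF S] indep[of h] by blast
qed

section \<open>Denominators\<close>

text \<open>
  Products with $k$ factors from $R a_n$ followed by a factor from $R$. The set replaces the $k$-th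
  power of the ideal generated by $a_n$: it is stable under multiplication from both
  sides, but sums of products are left out.
\<close>

primrec lead_power :: "nat \<Rightarrow> 'b set" where
  "lead_power 0 = UNIV"
| "lead_power (Suc k) = {s * a n * p | s p. p \<in> lead_power k}"

lemma lead_power_left: "p \<in> lead_power k \<Longrightarrow> s * p \<in> lead_power k"
proof (cases k)
  case (Suc l)
  assume "p \<in> lead_power k"
  then obtain t q where "p = t * a n * q" "q \<in> lead_power l"
    by (auto simp: Suc)
  then have "s * p = (s * t) * a n * q"
    by (simp add: mult.assoc)
  then show ?thesis
    using \<open>q \<in> lead_power l\<close> by (auto simp: Suc)
qed simp

lemma lead_power_right: "p \<in> lead_power k \<Longrightarrow> p * s \<in> lead_power k"
  by (induction k arbitrary: p) (auto, metis mult.assoc)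

lemma lead_power_antimono: "k \<le> l \<Longrightarrow> lead_power l \<subseteq> lead_power k"
  by (induction rule: dec_induct) (auto intro: lead_power_left)

lemma lead_power_nonzero: "u \<notin> Q \<Longrightarrow> \<exists>p\<in>lead_power k. u \<star> p \<notin> Q"
proof (induction k arbitrary: u)
  case 0
  then show ?case using torsion_free[of u] by auto
next
  case (Suc k)
  obtain s where "u \<star> (s * a n) \<notin> Q"
    using torsion_free[of u] Suc.prems by blast
  then obtain p where "p \<in> lead_power k" "u \<star> (s * a n) \<star> p \<notin> Q"
    using Suc.IH by blast
  then have "s * a n * p \<in> lead_power (Suc k)" "u \<star> (s * a n * p) \<notin> Q"
    by (auto simp: act_mult)
  then show ?case by blast
qed

definition conductor :: "'a set \<Rightarrow> 'a set" where
  "conductor N = {w. \<exists>k. \<forall>p\<in>lead_power k. w \<star> p \<in> N}"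

text \<open>
  One additional factor $s a_n$ absorbs one application of a ratio, since $(\lambda_i u) s a_n = u s a_i$.
  So for each element of $vB$ some power of $a_n$ is a denominator over $vR$.
\<close>

lemma ratio_submodule_conductor:
  assumes N: "submodule N"
  shows "ratio_submodule (conductor N)"
  unfolding ratio_submodule_def
proof (intro conjI allI impI ballI)
  show "submodule (conductor N)"
  proof (rule submoduleI)
    show "Q \<subseteq> conductor N"
      by (auto simp: conductor_def submodule_Q[OF N] Q_act)
    show "u + w \<in> conductor N" if uw: "u \<in> conductor N" "w \<in> conductor N" for u w
    proof -
      obtain k l where "\<forall>p\<in>lead_power k. u \<star> p \<in> N" "\<forall>p\<in>lead_power l. w \<star> p \<in> N"
        using uw by (auto simp: conductor_def)
      then have "(u + w) \<star> p \<in> N" if "p \<in> lead_power (max k l)" for p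
        using that lead_power_antimono[of k "max k l"] lead_power_antimono[of l "max k l"]
        by (simp add: act_add_left subset_iff submodule_add[OF N])
      then show ?thesis
        unfolding conductor_def by blast
    qed
    show "- u \<in> conductor N" if "u \<in> conductor N" for u
      using that submodule_minus[OF N] by (fastforce simp: conductor_def act_minus)
    show "u \<star> r \<in> conductor N" if "u \<in> conductor N" for u r
      using that lead_power_left by (fastforce simp: conductor_def simp flip: act_mult)
  qed
  fix i u
  assume i: "i < n" and "u \<in> conductor N"
  then obtain k where k: "\<forall>p\<in>lead_power k. u \<star> p \<in> N"
    by (auto simp: conductor_def)
  have "ratio i u \<star> (s * a n * p) \<in> N" if "p \<in> lead_power k" for s p
  proof -
    have "ratio i u \<star> (s * a n * p) - u \<star> (s * a i * p) \<in> Q"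
      using Q_act[OF ratio[of i u s], of p] i by (simp add: act_diff act_mult)
    moreover have "u \<star> (s * a i * p) \<in> N"
      using k that lead_power_left by blast
    ultimately show ?thesis
      using submodule_cong[OF N] by blast
  qed
  then have "\<forall>p\<in>lead_power (Suc k). ratio i u \<star> p \<in> N"
    by auto
  then show "ratio i u \<in> conductor N"
    unfolding conductor_def by blast
qed

lemma submodule_colon:
  assumes N: "submodule N"
  shows "submodule {w. \<forall>p\<in>lead_power k. w \<star> p \<in> N}"
  by (rule submoduleI)
    (auto simp: act_add_left act_minus submodule_Q[OF N] Q_act submodule_add[OF N]
      submodule_minus[OF N] lead_power_left simp flip: act_mult)

lemma translates_cyclicE:
  assumes "w \<in> translates (cyclic v) E"
  obtains r where "w - (\<Sum>i\<in>E. (X ^^ i) (v \<star> r i)) \<in> Q"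
proof -
  obtain y where y: "\<forall>i\<in>E. y i \<in> cyclic v" "w - (\<Sum>i\<in>E. (X ^^ i) (y i)) \<in> Q"
    using assms by (rule translatesE)
  then have "\<forall>i\<in>E. \<exists>r. y i - v \<star> r \<in> Q"
    by (simp add: cyclic_def)
  then obtain r where r: "\<forall>i\<in>E. y i - v \<star> r i \<in> Q"
    by (rule bchoice[THEN exE])
  have "(\<Sum>i\<in>E. (X ^^ i) (y i - v \<star> r i)) \<in> Q"
    using r by (intro Q_sum Q_X_pow) blast
  then have "(\<Sum>i\<in>E. (X ^^ i) (y i)) - (\<Sum>i\<in>E. (X ^^ i) (v \<star> r i)) \<in> Q"
    by (simp add: X_pow_diff sum_subtractf)
  with y(2) have "w - (\<Sum>i\<in>E. (X ^^ i) (v \<star> r i)) \<in> Q"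
    by (rule Q_trans)
  then show thesis
    by (rule that)
qed

section \<open>Nilpotency against simplicity\<close>

text \<open>
  The contradiction described at the beginning. The projections $\delta_i$ do not occur explicitly: the
  kernel of $\delta_i$ is $S \cap \sum_{k \neq i} Sx^{J+k}$, which must be zero or $S$.
\<close>

theorem no_proper_relation: False
proof -
  obtain S h where S: "ratio_submodule S" "\<not> S \<subseteq> Q"
    "\<forall>Y. ratio_submodule Y \<longrightarrow> Y \<subseteq> S \<longrightarrow> Y \<subseteq> Q \<or> Y = S"
    and indep: "\<forall>y. (\<forall>i<h. y i \<in> S) \<longrightarrow> (\<Sum>i<h. (X ^^ i) (y i)) \<in> Q \<longrightarrow> (\<forall>i<h. y i \<in> Q)"
    and span: "translates S {..<h} = UNIV"
    by (rule direct_decomposition)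
  note S' = ratio_submoduleD(1)[OF S(1)]
  obtain v where v: "v \<in> S" "v \<notin> Q"
    using S(2) by blast
  define N where "N = translates (cyclic v) {..<h}"
  have N: "submodule N"
    unfolding N_def by (rule submodule_translates[OF submodule_cyclic])
  have "ratio_submodule (S \<inter> conductor (cyclic v))"
    by (intro ratio_submodule_Int S(1) ratio_submodule_conductor submodule_cyclic)
  moreover have "v \<in> conductor (cyclic v)"
    unfolding conductor_def by (auto intro: exI[of _ 0] cyclic_act)
  ultimately have cond_S: "S \<subseteq> conductor (cyclic v)"
    using S(3) v by blast
  have "translates S {..<h} \<subseteq> conductor N"
  proof (rule translates_least)
    show "submodule (conductor N)"
      by (rule ratio_submoduleD(1)[OF ratio_submodule_conductor[OF N]])
    fix i y
    assume i: "i \<in> {..<h}" and "y \<in> S"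
    then obtain k where k: "\<forall>p\<in>lead_power k. y \<star> p \<in> cyclic v"
      using cond_S by (auto simp: conductor_def)
    have "(X ^^ i) y \<star> p \<in> N" if "p \<in> lead_power k" for p
      using translates_pow[OF submodule_cyclic, of "{..<h}" i "y \<star> p"] i k that
      by (simp add: N_def X_pow_act)
    then show "(X ^^ i) y \<in> conductor N"
      unfolding conductor_def by blast
  qed
  then have "\<forall>i. \<exists>k. \<forall>p\<in>lead_power k. (X ^^ i) v \<star> p \<in> N"
    using span by (auto simp: conductor_def)
  then obtain kk where kk: "\<forall>i. \<forall>p\<in>lead_power (kk i). (X ^^ i) v \<star> p \<in> N"
    by metis
  obtain d where d: "v \<in> translates (cyclic v) {1..d}"
    using generator_window[OF v(2)] .
  \<comment> \<open>The sum is an upper bound for the finitely many exponents; likewise for $J$ below.\<close>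
  define K where "K = sum kk {1..d}"
  have K: "(X ^^ i) v \<star> p \<in> N" if "i \<in> {1..d}" "p \<in> lead_power K" for i p
  proof -
    have "kk i \<le> K"
      unfolding K_def using that(1) by (intro member_le_sum) auto
    then show ?thesis
      using kk that(2) lead_power_antimono by blast
  qed
  \<comment> \<open>The window $\{j+1, \dots, j+d\}$ is the translate by $j$ of $\{1, \dots, d\}$, so that one
    exponent $K$ works for all $j$.\<close>
  have window: "w \<star> p \<in> translates (cyclic v) ((+) j ` {..<h})"
    if w: "w \<in> translates (cyclic v) {j + 1..j + d}" and p: "p \<in> lead_power K" for w p j
  proof -
    let ?T = "translates (cyclic v) ((+) j ` {..<h})"
    let ?C = "{w. \<forall>p\<in>lead_power K. w \<star> p \<in> ?T}"
    have C: "submodule ?C"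
      by (intro submodule_colon submodule_translates submodule_cyclic)
    have "translates (cyclic v) {j + 1..j + d} \<subseteq> ?C"
    proof (rule translates_least[OF C])
      fix i y
      assume i: "i \<in> {j + 1..j + d}" and "y \<in> cyclic v"
      then obtain r where r: "y - v \<star> r \<in> Q"
        unfolding cyclic_def by blast
      have "(X ^^ i) (v \<star> r) \<star> q \<in> ?T" if q: "q \<in> lead_power K" for q
      proof -
        have "(X ^^ (i - j)) v \<star> (r * q) \<in> N"
          using i q by (intro K lead_power_left) auto
        from translates_shift[OF this[unfolded N_def], of j] show ?thesis
          using i by (simp add: X_pow_act X_pow_pow act_mult)
      qed
      then have "(X ^^ i) (v \<star> r) \<in> ?C"
        by blast
      moreover have "(X ^^ i) y - (X ^^ i) (v \<star> r) \<in> Q"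
        using Q_X_pow[OF r] by (simp add: X_pow_diff)
      ultimately show "(X ^^ i) y \<in> ?C"
        using submodule_cong[OF C] by blast
    qed
    then show ?thesis
      using w p by blast
  qed
  obtain p where p: "p \<in> lead_power K" "v \<star> p \<notin> Q"
    using lead_power_nonzero[OF v(2)] by blast
  \<comment> \<open>$v$ is a combination of the $v p r_l x^l = (v x^l) p r_l$, to which \<open>window\<close> applies.\<close>
  obtain k r where kr: "v - (\<Sum>l<k. (X ^^ l) (v \<star> p \<star> r l)) \<in> Q"
    using simple[OF p(2)] by blast
  have "\<forall>l. \<exists>j0. \<forall>j\<ge>j0. (X ^^ l) v \<in> translates (cyclic v) {j + 1..j + d}"
    using eventually_in_window[OF v(2) d] by blast
  then obtain j0 where j0: "\<forall>l. \<forall>j\<ge>j0 l. (X ^^ l) v \<in> translates (cyclic v) {j + 1..j + d}"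
    by (rule choice[THEN exE])
  define J where "J = sum j0 {..<k}"
  have "v \<in> translates (cyclic v) ((+) J ` {..<h})" (is "_ \<in> ?T")
  proof -
    have T: "submodule ?T"
      by (intro submodule_translates submodule_cyclic)
    have "(X ^^ l) (v \<star> p \<star> r l) \<in> ?T" if "l < k" for l
    proof -
      have "j0 l \<le> J"
        unfolding J_def using that by (intro member_le_sum) auto
      then have "(X ^^ l) v \<star> (p * r l) \<in> ?T"
        using j0 p(1) by (intro window lead_power_right) auto
      then show ?thesis
        by (simp add: X_pow_act act_mult)
    qed
    then have "(\<Sum>l<k. (X ^^ l) (v \<star> p \<star> r l)) \<in> ?T"
      by (intro submodule_sum[OF T]) simp
    then show ?thesis
      using submodule_cong[OF T kr] by blast
  qed
  then obtain c' where c': "v - (\<Sum>i\<in>(+) J ` {..<h}. (X ^^ i) (v \<star> c' i)) \<in> Q"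
    by (rule translates_cyclicE)
  define c where "c i = c' (J + i)" for i
  have c: "v - (\<Sum>i<h. (X ^^ (J + i)) (v \<star> c i)) \<in> Q"
    using c' by (simp add: sum.reindex c_def)
  have "v \<star> c i \<in> Q" if i: "i < h" for i
  proof (rule ccontr)
    assume nz: "v \<star> c i \<notin> Q"
    \<comment> \<open>If $v c_i^{m+1} = 0 \neq v c_i^m$, then $\delta_i$ kills a nonzero element, hence is zero,
      whereas $\delta_i(v) = v c_i \neq 0$.\<close>
    have "v \<star> power_Suc_nonunital (c i) m \<notin> Q" for m
    proof (induction m)
      case 0
      show ?case using nz by simp
    next
      case (Suc m)
      let ?s = "power_Suc_nonunital (c i) m"
      let ?E = "{..<h} - {i}"
      let ?B = "S \<inter> translates S ((+) J ` ?E)"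
      show ?case
      proof
        assume "v \<star> power_Suc_nonunital (c i) (Suc m) \<in> Q"
        then have zero: "v \<star> c i \<star> ?s \<in> Q"
          by (simp add: act_mult)
        have split: "(\<Sum>k<h. f k) = f i + sum f ?E" for f :: "nat \<Rightarrow> 'a"
          using i by (intro sum.remove) auto
        have "v \<star> ?s - (\<Sum>k<h. (X ^^ (J + k)) (v \<star> c k \<star> ?s)) \<in> Q"
          using Q_act[OF c, of ?s] by (simp add: act_diff act_sum X_pow_act)
        then have "v \<star> ?s - (\<Sum>k\<in>?E. (X ^^ (J + k)) (v \<star> c k \<star> ?s)) \<in> Q"
          using Q_add[OF _ Q_X_pow[OF zero, of "J + i"]] unfolding split
          by (fastforce simp: algebra_simps)
        moreover have "v \<star> c k \<star> ?s \<in> S" for k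
          using v(1) submodule_act[OF S'] by blast
        ultimately have "v \<star> ?s \<in> translates S ((+) J ` ?E)"
          by (intro translatesI[where y = "\<lambda>k. v \<star> c (k - J) \<star> ?s"]) (auto simp: sum.reindex)
        moreover have "v \<star> ?s \<in> S"
          by (rule submodule_act[OF S' v(1)])
        moreover have "ratio_submodule ?B"
          by (intro ratio_submodule_Int S(1) ratio_submodule_translates) auto
        ultimately have "v \<in> ?B"
          using S(3) Suc.IH v(1) by blast
        then obtain y where y: "\<forall>k\<in>(+) J ` ?E. y k \<in> S"
          "v - (\<Sum>k\<in>(+) J ` ?E. (X ^^ k) (y k)) \<in> Q"
          by (auto elim: translatesE)
        define z where "z k = v \<star> c k - (if k = i then 0 else y (J + k))" for k
        have "(\<Sum>k<h. (X ^^ (J + k)) (if k = i then 0 else y (J + k)))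
            = (\<Sum>k\<in>?E. (X ^^ (J + k)) (y (J + k)))"
          unfolding split by (auto intro!: sum.cong)
        then have "v - (\<Sum>k<h. (X ^^ (J + k)) (if k = i then 0 else y (J + k))) \<in> Q"
          using y(2) by (simp add: sum.reindex)
        from Q_trans[OF Q_sym[OF c] this] have "(\<Sum>k<h. (X ^^ (J + k)) (z k)) \<in> Q"
          by (simp add: z_def X_pow_diff sum_subtractf)
        then have "(X ^^ J) (\<Sum>k<h. (X ^^ k) (z k)) \<in> Q"
          by (simp add: X_pow_sum X_pow_pow)
        then have "(\<Sum>k<h. (X ^^ k) (z k)) \<in> Q"
          by (rule X_pow_inj)
        moreover have "\<forall>k<h. z k \<in> S"
          using y(1) v(1) by (auto simp: z_def intro!: submodule_diff[OF S'] submodule_act[OF S']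
              submodule_Q[OF S' Q_zero])
        ultimately have "z i \<in> Q"
          using indep i by blast
        then show False
          using nz by (simp add: z_def)
      qed
    qed
    moreover obtain m where "power_Suc_nonunital (c i) m = 0"
      using nil unfolding nilpotent_def by blast
    ultimately show False
      by (metis act_zero(2) Q_zero)
  qed
  then have "(\<Sum>i<h. (X ^^ (J + i)) (v \<star> c i)) \<in> Q"
    by (intro Q_sum Q_X_pow) simp
  then show False
    using submodule_cong[OF submodule_Q_self c] v(2) by blast
qed

end


section \<open>Annihilating polynomials\<close>

context simple_shift_module
begin

text \<open>
  Leading coefficients that annihilate the module can be dropped.
\<close>

lemma relation_truncate:
  assumes "\<And>u. (\<Sum>i\<le>n. (X ^^ i) (u \<star> a i)) \<in> Q" "i \<le> n" "u \<star> a i \<notin> Q"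
  shows "\<exists>m\<le>n. (\<forall>u. (\<Sum>i\<le>m. (X ^^ i) (u \<star> a i)) \<in> Q) \<and> (\<exists>u. u \<star> a m \<notin> Q)"
  using assms(1,2)
proof (induction n)
  case 0
  then show ?case using assms(3) by auto
next
  case (Suc n)
  show ?case
  proof (cases "\<exists>u. u \<star> a (Suc n) \<notin> Q")
    case True
    then show ?thesis using Suc.prems(1) by blast
  next
    case False
    then have top: "(X ^^ Suc n) (w \<star> a (Suc n)) \<in> Q" for w
      by (blast intro: Q_X_pow)
    have "i \<le> n"
      using Suc.prems(2) False assms(3) le_Suc_eq by blast
    moreover have "(\<Sum>i\<le>n. (X ^^ i) (w \<star> a i)) \<in> Q" for w
      using Q_diff[OF Suc.prems(1)[of w] top[of w]] by (simp del: funpow.simps)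
    ultimately show ?thesis
      using Suc.IH le_SucI by blast
  qed
qed

text \<open>
  Among the relations with leading coefficient outside the annihilator take one, $c$, of
  least degree $m$. For each $r$ the coefficients $c_m r c_k - c_k r c_m$ form a relation whose
  coefficient of degree $m$ vanishes, so by minimality all of them annihilate the module. This is the
  commutation rule of \<open>algebraic_shift_module\<close>.
\<close>

theorem relation_trivial:
  assumes rel: "\<And>u. (\<Sum>i\<le>n. (X ^^ i) (u \<star> a i)) \<in> Q" and i: "i \<le> n"
  shows "u \<star> a i \<in> Q"
proof (rule ccontr)
  assume nz: "u \<star> a i \<notin> Q"
  define R where "R m c \<longleftrightarrow> (\<forall>u. (\<Sum>i\<le>m. (X ^^ i) (u \<star> c i)) \<in> Q) \<and> (\<exists>u. u \<star> c m \<notin> Q)"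
    for m :: nat and c :: "nat \<Rightarrow> 'b"
  define m where "m = (LEAST m. \<exists>c. R m c)"
  have "\<exists>m c. R m c"
    using relation_truncate[OF rel i nz] by (auto simp: R_def)
  then have "\<exists>c. R m c"
    unfolding m_def by (rule LeastI_ex)
  then obtain c where c: "R m c" ..
  have minimal: "m \<le> k" if "R k d" for k d
    unfolding m_def using that by (blast intro: Least_le)
  have "w \<star> (c m * r * c k) - w \<star> (c k * r * c m) \<in> Q" if k: "k \<le> m" for k w r
  proof (rule ccontr)
    define d where "d k = c m * r * c k - c k * r * c m" for k
    assume "w \<star> (c m * r * c k) - w \<star> (c k * r * c m) \<notin> Q"
    then have "w \<star> d k \<notin> Q"
      by (simp add: d_def act_diff)
    moreover have "(\<Sum>i\<le>m. (X ^^ i) (z \<star> d i)) \<in> Q" for z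
    proof -
      have "(\<Sum>i\<le>m. (X ^^ i) (z \<star> c m \<star> r \<star> c i)) \<in> Q"
        "(\<Sum>i\<le>m. (X ^^ i) (z \<star> c i)) \<star> r \<star> c m \<in> Q"
        using c by (auto simp: R_def intro!: Q_act)
      from Q_diff[OF this] show ?thesis
        by (simp add: d_def act_diff act_mult act_sum X_pow_act X_pow_diff sum_subtractf)
    qed
    ultimately obtain l where "l \<le> m" "R l d"
      using relation_truncate[where n = m and a = d and i = k and u = w] k unfolding R_def by blast
    then have "R m d"
      using minimal[OF \<open>R l d\<close>] by simp
    then show False
      by (simp add: R_def d_def Q_zero)
  qed
  then interpret algebraic_shift_module act X Q c m
    using c by unfold_locales (auto simp: R_def)
  show False
    by (rule no_proper_relation)
qed

end

section \<open>Multiplication by the indeterminate\<close>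

text \<open>
  Multiplication by $x$, which is not an element of $R[x]$ when $R$ has no identity.
\<close>

lift_definition poly_shift :: "'a::zero npoly \<Rightarrow> 'a npoly"
  is "\<lambda>f k. case k of 0 \<Rightarrow> 0 | Suc i \<Rightarrow> f i"
proof -
  fix f :: "nat \<Rightarrow> 'a"
  assume "finite {k. f k \<noteq> 0}"
  moreover have "{k. (case k of 0 \<Rightarrow> 0 | Suc i \<Rightarrow> f i) \<noteq> 0} \<subseteq> Suc ` {k. f k \<noteq> 0}"
    by (auto simp: image_iff gr0_conv_Suc split: nat.splits)
  ultimately show "finite {k. (case k of 0 \<Rightarrow> 0 | Suc i \<Rightarrow> f i) \<noteq> 0}"
    by (meson finite_imageI finite_subset)
qed

lemma poly_shift_add: "poly_shift (p + q) = poly_shift p + poly_shift (q :: 'a::monoid_add npoly)"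
  by transfer (auto split: nat.splits)

lemma poly_shift_zero [simp]: "poly_shift 0 = 0"
  by transfer (auto split: nat.splits)

lemma poly_shift_sum:
  "poly_shift (\<Sum>i\<in>E. f i) = (\<Sum>i\<in>E. poly_shift (f i :: 'a::comm_monoid_add npoly))"
  by (induction E rule: infinite_finite_induct) (simp_all add: poly_shift_add)

lemma poly_shift_single: "poly_shift (Poly_Mapping.single k c) = Poly_Mapping.single (Suc k) c"
  by transfer (auto simp: when_def split: nat.splits)

lemma npoly_expansion:
  fixes p :: "'a::comm_monoid_add npoly"
  assumes "finite E" "Poly_Mapping.keys p \<subseteq> E"
  shows "p = (\<Sum>k\<in>E. Poly_Mapping.single k (Poly_Mapping.lookup p k))"
  using assms
  by (intro poly_mapping_eqI)
    (auto simp: lookup_sum lookup_single when_def in_keys_iff)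

lemma poly_shift_mult:
  fixes p q :: "'a::ring npoly"
  shows "poly_shift (p * q) = poly_shift p * q" "poly_shift (p * q) = p * poly_shift q"
proof -
  let ?t = "\<lambda>r. (\<Sum>k\<in>Poly_Mapping.keys r. Poly_Mapping.single k (Poly_Mapping.lookup r k))"
  have "poly_shift (?t p * ?t q) = poly_shift (?t p) * ?t q"
    "poly_shift (?t p * ?t q) = ?t p * poly_shift (?t q)"
    by (simp_all add: sum_product poly_shift_sum poly_shift_single mult_single)
  then show "poly_shift (p * q) = poly_shift p * q" "poly_shift (p * q) = p * poly_shift q"
    by (simp_all flip: npoly_expansion)
qed

lemma poly_shift_pow_mult_const:
  fixes p :: "'a::ring npoly"
  shows "(poly_shift ^^ i) (p * Poly_Mapping.single 0 c) = p * Poly_Mapping.single i c"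
  by (induction i) (simp_all add: poly_shift_mult(2) poly_shift_single)

lemma npoly_mult_expansion:
  fixes p q :: "'a::ring npoly"
  assumes "Poly_Mapping.keys q \<subseteq> E" "finite E"
  shows "p * q = (\<Sum>i\<in>E. (poly_shift ^^ i) (p * Poly_Mapping.single 0 (Poly_Mapping.lookup q i)))"
  by (subst npoly_expansion[OF assms(2,1)])
    (simp add: sum_distrib_left poly_shift_pow_mult_const)

section \<open>Modular maximal right ideals and primitive ideals\<close>

context
  fixes Q :: "'a::ring set"
  assumes Q: "modular_maximal_right_ideal Q"
begin

lemma modular_maximal_right_idealD:
  shows "0 \<in> Q" "a \<in> Q \<Longrightarrow> b \<in> Q \<Longrightarrow> a + b \<in> Q" "a \<in> Q \<Longrightarrow> - a \<in> Q" "a \<in> Q \<Longrightarrow> a * s \<in> Q"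
    "Q \<noteq> UNIV" "\<exists>b. \<forall>a. a - b * a \<in> Q"
    "right_ideal J \<Longrightarrow> J \<noteq> UNIV \<Longrightarrow> Q \<subseteq> J \<Longrightarrow> J = Q"
  using Q unfolding modular_maximal_right_ideal_def modular_right_ideal_def right_ideal_def
    additive_subgroup_def by auto

text \<open>
  The elements $a$ with $aR \subseteq Q$ form a right ideal containing $Q$. It is not the whole ring, for
  otherwise $ba \in Q$ and $a - ba \in Q$ would put every $a$ into $Q$.
\<close>

lemma modular_maximal_right_ideal_absorb:
  assumes a: "\<And>s. a * s \<in> Q"
  shows "a \<in> Q"
proof -
  let ?J = "{a. \<forall>s. a * s \<in> Q}"
  have "right_ideal ?J"
    unfolding right_ideal_def additive_subgroup_def
    by (auto simp: distrib_right mult.assoc modular_maximal_right_idealD(1-4))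
  moreover have "?J \<noteq> UNIV"
  proof
    assume J: "?J = UNIV"
    obtain b where b: "\<forall>a. a - b * a \<in> Q"
      using modular_maximal_right_idealD(6) ..
    have "a \<in> Q" for a
      using modular_maximal_right_idealD(2)[of "a - b * a" "b * a"] b J by auto
    then show False
      using modular_maximal_right_idealD(5) by blast
  qed
  ultimately show ?thesis
    using modular_maximal_right_idealD(4) modular_maximal_right_idealD(7)[where J = ?J] a by blast
qed

text \<open>
  The right ideal $uR + Q$ contains $Q$ properly by \<open>modular_maximal_right_ideal_absorb\<close>.
\<close>

lemma modular_maximal_right_ideal_generate:
  assumes u: "u \<notin> Q"
  shows "\<exists>s. w - u * s \<in> Q"
proof -
  let ?J = "{w. \<exists>s. w - u * s \<in> Q}"
  have "right_ideal ?J"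
    unfolding right_ideal_def additive_subgroup_def
  proof (intro conjI ballI allI)
    show "0 \<in> ?J"
      by (auto intro!: exI[of _ 0] modular_maximal_right_idealD(1))
    fix a
    assume "a \<in> ?J"
    then obtain s where s: "a - u * s \<in> Q" by blast
    show "- a \<in> ?J"
      using modular_maximal_right_idealD(3)[OF s] by (auto intro!: exI[of _ "- s"])
    show "a * t \<in> ?J" for t
      using modular_maximal_right_idealD(4)[OF s, of t]
      by (auto intro!: exI[of _ "s * t"] simp: left_diff_distrib mult.assoc)
    fix b
    assume "b \<in> ?J"
    then obtain t where t: "b - u * t \<in> Q" by blast
    show "a + b \<in> ?J"
      using modular_maximal_right_idealD(2)[OF s t]
      by (auto intro!: exI[of _ "s + t"] simp: algebra_simps)
  qed
  moreover have "Q \<subseteq> ?J"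
    by (auto intro!: exI[of _ 0])
  moreover have "?J \<noteq> Q"
  proof
    assume "?J = Q"
    moreover have "u * s \<in> ?J" for s
      by (auto intro!: exI[of _ s] modular_maximal_right_idealD(1))
    ultimately show False
      using modular_maximal_right_ideal_absorb u by blast
  qed
  ultimately have "?J = UNIV"
    using modular_maximal_right_idealD(7) by blast
  then show ?thesis by blast
qed

end

text \<open>
  The annihilator of $R/Q$ is a two-sided ideal, and it is contained in $Q$ since $p - bp \in Q$.
\<close>

lemma right_primitive_annihilator:
  fixes P :: "'a::ring set"
  assumes "right_primitive P"
  obtains Q where "modular_maximal_right_ideal Q" "\<And>p. p \<in> P \<longleftrightarrow> (\<forall>u. u * p \<in> Q)"
proof -
  obtain Q where P: "two_sided_ideal P" and Q: "modular_maximal_right_ideal Q" "P \<subseteq> Q"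
    and largest: "\<forall>J. two_sided_ideal J \<and> J \<subseteq> Q \<longrightarrow> J \<subseteq> P"
    using assms unfolding right_primitive_def by blast
  note QD = modular_maximal_right_idealD[OF Q(1)]
  let ?Z = "{p. \<forall>u. u * p \<in> Q}"
  have "two_sided_ideal ?Z"
    unfolding two_sided_ideal_def additive_subgroup_def
    by (auto simp: distrib_left QD(1-4) simp flip: mult.assoc)
  moreover have "?Z \<subseteq> Q"
  proof
    fix p
    assume p: "p \<in> ?Z"
    obtain b where "\<forall>a. a - b * a \<in> Q"
      using QD(6) ..
    then show "p \<in> Q"
      using QD(2)[of "p - b * p" "b * p"] p by auto
  qed
  ultimately have "?Z \<subseteq> P"
    using largest by blast
  moreover have "P \<subseteq> ?Z"
    using P Q(2) unfolding two_sided_ideal_def by blast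
  ultimately show thesis
    using that Q(1) by blast
qed

section \<open>Primitive ideals of polynomial rings over nil rings\<close>

text \<open>
  For $q \in Q$ the shift $qx$ stays in $Q$ although $x$ may not be in the ring: $(qx)s = q(xs) \in Q$ for
  every $s$, and \<open>modular_maximal_right_ideal_absorb\<close> applies.
\<close>

lemma simple_shift_module_quotient:
  fixes Q :: "'a::ring npoly set"
  assumes Q: "modular_maximal_right_ideal Q" and nil: "\<And>a::'a. nilpotent a"
  shows "simple_shift_module (\<lambda>u r. u * Poly_Mapping.single 0 r) poly_shift Q"
proof
  note QD = modular_maximal_right_idealD[OF Q]
  fix u w :: "'a npoly" and r s :: 'a
  show "(u + w) * Poly_Mapping.single 0 r = u * Poly_Mapping.single 0 r + w * Poly_Mapping.single 0 r"
    by (rule distrib_right)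
  show "u * Poly_Mapping.single 0 (r + s) = u * Poly_Mapping.single 0 r + u * Poly_Mapping.single 0 s"
    by (simp add: single_add distrib_left)
  show "u * Poly_Mapping.single 0 (r * s) = u * Poly_Mapping.single 0 r * Poly_Mapping.single 0 s"
    by (simp add: mult.assoc mult_single)
  show "poly_shift (u + w) = poly_shift u + poly_shift w"
    by (rule poly_shift_add)
  show "poly_shift (u * Poly_Mapping.single 0 r) = poly_shift u * Poly_Mapping.single 0 r"
    by (rule poly_shift_mult(1))
  show "0 \<in> Q"
    by (rule QD(1))
  show "u + w \<in> Q" if "u \<in> Q" "w \<in> Q"
    using that by (rule QD(2))
  show "- u \<in> Q" if "u \<in> Q"
    using that by (rule QD(3))
  show "u * Poly_Mapping.single 0 r \<in> Q" if "u \<in> Q"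
    using that by (rule QD(4))
  show "poly_shift u \<in> Q" if "u \<in> Q"
  proof (rule modular_maximal_right_ideal_absorb[OF Q])
    show "poly_shift u * s \<in> Q" for s
      using QD(4)[OF that, of "poly_shift s"] by (simp flip: poly_shift_mult)
  qed
  show "\<exists>k r. w - (\<Sum>i<k. (poly_shift ^^ i) (u * Poly_Mapping.single 0 (r i))) \<in> Q" if "u \<notin> Q"
  proof -
    obtain s where s: "w - u * s \<in> Q"
      using modular_maximal_right_ideal_generate[OF Q \<open>u \<notin> Q\<close>] by blast
    obtain k where "Poly_Mapping.keys s \<subseteq> {..<k}"
      using finite_nat_set_iff_bounded[of "Poly_Mapping.keys s"] by auto
    from npoly_mult_expansion[OF this, of u] s show ?thesis
      by (intro exI[of _ k] exI[of _ "Poly_Mapping.lookup s"]) simp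
  qed
  show "nilpotent r"
    by (rule nil)
qed

theorem theorem1:
  fixes I :: "'a::ring npoly set"
  assumes nil: "\<And>a::'a. nilpotent a"
    and prim: "right_primitive I"
  shows "\<exists>I'::'a set. two_sided_ideal I' \<and> I = ideal_poly I'"
proof -
  obtain Q where Q: "modular_maximal_right_ideal Q"
    and I: "\<And>p. p \<in> I \<longleftrightarrow> (\<forall>u. u * p \<in> Q)"
    using right_primitive_annihilator[OF prim] by metis
  note QD = modular_maximal_right_idealD[OF Q]
  interpret simple_shift_module "\<lambda>u r. u * Poly_Mapping.single 0 r" poly_shift Q
    using Q nil by (rule simple_shift_module_quotient)
  define I' where "I' = {r. \<forall>u. u * Poly_Mapping.single 0 r \<in> Q}"
  have "two_sided_ideal I'"
    unfolding two_sided_ideal_def additive_subgroup_def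
    by (auto simp: I'_def act_add_right act_minus act_mult QD(1-4))
  moreover have "I = ideal_poly I'"
  proof (intro set_eqI iffI)
    fix p
    assume p: "p \<in> I"
    have "Poly_Mapping.lookup p i \<in> I'" for i
    proof -
      obtain m where "Poly_Mapping.keys p \<subseteq> {..m}"
        using finite_nat_set_iff_bounded_le[of "Poly_Mapping.keys p"] by auto
      then have "Poly_Mapping.keys p \<subseteq> {..max m i}"
        by fastforce
      from npoly_mult_expansion[OF this]
      have "(\<Sum>k\<le>max m i. (poly_shift ^^ k) (u * Poly_Mapping.single 0 (Poly_Mapping.lookup p k))) \<in> Q"
        for u
        using p by (simp add: I)
      from relation_trivial[OF this, of i] show ?thesis
        by (simp add: I'_def)
    qed
    then show "p \<in> ideal_poly I'"
      by (simp add: ideal_poly_def)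
  next
    fix p
    assume "p \<in> ideal_poly I'"
    then have p: "u * Poly_Mapping.single 0 (Poly_Mapping.lookup p i) \<in> Q" for u i
      by (simp add: ideal_poly_def I'_def)
    have "u * p \<in> Q" for u
      by (subst npoly_mult_expansion[OF subset_refl]) (auto intro!: Q_sum Q_X_pow p)
    then show "p \<in> I"
      by (simp add: I)
  qed
  ultimately show ?thesis by blast
qed

end
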